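(* Let $h(\mathbf{x})=\bm{\beta}^\top\phi(\mathbf{x})$ be a trained model with feature map $\phi:\mathcal{X}\to\mathcal{H}$ and weights $\bm{\beta}$ with columns $\bm{\beta}_1,\ldots,\bm{\beta}_C\in\mathcal{H}$. Assume that the distribution $\mathcal{D}$ of $(\mathbf{x},y)$ is such that $y=h(\mathbf{x})+\bm{\epsilon}$, where $\bm{\epsilon}\in\mathbb{R}^C$ has independent coordinates with $\mathbb{E}[\epsilon_c]=0$ and $\mathbb{E}[\epsilon_c^2]\le\sigma^2$ for all $c\in\{1,\ldots,C\}$, and that $\phi$ is $L$-Lipschitz, i.e. $\|\phi(\mathbf{x})-\phi(\tilde{\mathbf{x}})\|_{\mathcal{H}}\le L\|\mathbf{x}-\tilde{\mathbf{x}}\|$. Fix any $K$ and let $\Sigma=\mathbb{E}_{\mathbf{x}}[\phi(\mathbf{x})\phi(\mathbf{x})^\top]$. For a class $c\in\{1,\ldots,C\}$, consider the problem of maximizing the lower bound $$\bm{\beta}_c^\top\Sigma\bm{M}\bm{\beta}_c-L\,\Delta\,\|\bm{M}\|_{op}\,\|\bm{\beta}_c\|_{\mathcal{H}}\sqrt{\sigma^2+\bm{\beta}_c^\top\Sigma\bm{\beta}_c}$$ on the robustness $s_{\mathcal{D},\bm{\beta},c}(f)$ over all features $f=\bm{M}\phi$ that correspond to projection of $\phi$ onto a $K$-dimensional subspace (i.e. $\bm{M}=\bm{P}\bm{P}^\top$ with the columns of $\bm{P}$ an orthonormal basis of the subspace). Then the solution is $f=\tilde{\mathbf{U}}_c\tilde{\mathbf{U}}_c^\top\phi$,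 where $\tilde{\mathbf{U}}_c$ is the matrix of the $K$ top eigenvectors of the class-specific matrix $$\bm{B}_c:=\tfrac12\left(\bm{\beta}_c\bm{\beta}_c^\top\Sigma+\Sigma\bm{\beta}_c\bm{\beta}_c^\top\right).$$
   Context: $\mathcal{X}\subseteq\mathbb{R}^d$; $\mathcal{H}$ is the feature space (a Hilbert space, e.g. $\mathbb{R}^p$, in which case $\bm{\beta}\in\mathbb{R}^{p\times C}$); labels $y$ lie in $\mathbb{R}^C$. A feature is a map $f:\mathcal{X}\to\mathcal{H}$. For a perturbation budget $\Delta$, the robustness of $f$ with respect to the $c$-th class component is $s_{\mathcal{D},\bm{\beta},c}(f)=\mathbb{E}_{(\mathbf{x},y)\sim\mathcal{D}}\big[\inf_{\|\tilde{\mathbf{x}}-\mathbf{x}\|_2\le\Delta}y_c\,\bm{\beta}_c^\top f(\tilde{\mathbf{x}})\big]$. Under the stated assumptions, for every $f=\bm{M}\phi$ with $\bm{M}$ a linear map on $\mathcal{H}$, the displayed expression is a lower bound for $s_{\mathcal{D},\bm{\beta},c}(f)$; this is the lower bound being maximized. $\|\cdot\|_{op}$ denotes the operator norm. *)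

theory Defs
  imports "HOL-Probability.Probability"
begin

text \<open>
  The feature space is an arbitrary real Hilbert space: a type of sort
  \<open>{real_inner, banach}\<close>. The weight matrix is given by its columns \<open>\<beta> c\<close>, and a matrix
  with \<open>K\<close> columns in the feature space is a function on \<open>nat\<close>, of which only the values
  below \<open>K\<close> matter.
\<close>

definition linear_model ::
  "('x \<Rightarrow> 'h::real_inner) \<Rightarrow> ('c::finite \<Rightarrow> 'h) \<Rightarrow> 'x \<Rightarrow> real ^ 'c" where
  "linear_model \<phi> \<beta> x = (\<chi> c. \<beta> c \<bullet> \<phi> x)"

text \<open>
  \<open>S\<close> is the operator \<open>E[\<phi>(x) \<phi>(x)\<^sup>T]\<close>. The expectation is taken in the weak sense,
  which for \<open>\<real>\<^sup>p\<close> is the entrywise expectation and needs no separability of the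
  feature space; \<open>S\<close> is uniquely determined by \<open>D\<close> and \<open>\<phi>\<close>.
\<close>

definition has_second_moment_operator ::
  "('x \<times> 'y) measure \<Rightarrow> ('x \<Rightarrow> 'h::real_inner) \<Rightarrow> ('h \<Rightarrow> 'h) \<Rightarrow> bool" where
  "has_second_moment_operator D \<phi> S \<longleftrightarrow>
     bounded_linear S \<and>
     (\<forall>u v. integrable D (\<lambda>(x, y). (u \<bullet> \<phi> x) * (\<phi> x \<bullet> v)) \<and>
            u \<bullet> S v = (\<integral>(x, y). (u \<bullet> \<phi> x) * (\<phi> x \<bullet> v) \<partial>D))"

definition orthonormal_columns :: "nat \<Rightarrow> (nat \<Rightarrow> 'h::real_inner) \<Rightarrow> bool" where
  "orthonormal_columns K P \<longleftrightarrow> (\<forall>i<K. \<forall>j<K. P i \<bullet> P j = (if i = j then 1 else 0))"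

text \<open>The operator \<open>P P\<^sup>T\<close>.\<close>

definition PPt :: "nat \<Rightarrow> (nat \<Rightarrow> 'h::real_inner) \<Rightarrow> 'h \<Rightarrow> 'h" where
  "PPt K P v = (\<Sum>i<K. (P i \<bullet> v) *\<^sub>R P i)"

text \<open>
  The orthogonal projections onto the \<open>K\<close>-dimensional subspaces; the subspace belonging
  to \<open>P\<close> is the span of its columns, of which they form an orthonormal basis.
\<close>

definition projections :: "nat \<Rightarrow> ('h::real_inner \<Rightarrow> 'h) set" where
  "projections K = {PPt K P | P. orthonormal_columns K P}"

text \<open>
  The lower bound, for the feature \<open>f = M \<phi>\<close>, on the robustness
  \<open>E[inf {y\<^sub>c (b \<bullet> f x') | x'. \<parallel>x' - x\<parallel> \<le> \<Delta>}]\<close>, where \<open>b = \<beta> c\<close>.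
\<close>

definition robustness_lower_bound ::
  "real \<Rightarrow> real \<Rightarrow> real \<Rightarrow> ('h::real_inner \<Rightarrow> 'h) \<Rightarrow> 'h \<Rightarrow> ('h \<Rightarrow> 'h) \<Rightarrow> real" where
  "robustness_lower_bound L \<Delta> \<sigma> S b M =
     b \<bullet> S (M b) - L * \<Delta> * onorm M * norm b * sqrt (\<sigma>\<^sup>2 + b \<bullet> S b)"

definition optimal_features ::
  "nat \<Rightarrow> 'x set \<Rightarrow> ('x \<Rightarrow> 'h::real_inner) \<Rightarrow> (('h \<Rightarrow> 'h) \<Rightarrow> real) \<Rightarrow> ('x \<Rightarrow> 'h) set" where
  "optimal_features K X \<phi> J =
     {\<lambda>x\<in>X. M (\<phi> x) | M. is_arg_max J (\<lambda>M. M \<in> projections K) M}"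

text \<open>The operator \<open>(b b\<^sup>T S + S b b\<^sup>T) / 2\<close>.\<close>

definition class_operator :: "('h::real_inner \<Rightarrow> 'h) \<Rightarrow> 'h \<Rightarrow> 'h \<Rightarrow> 'h" where
  "class_operator S b v = (1/2) *\<^sub>R ((b \<bullet> S v) *\<^sub>R b + (b \<bullet> v) *\<^sub>R S b)"

text \<open>
  The columns of \<open>U\<close> are orthonormal eigenvectors belonging to the \<open>K\<close> largest eigenvalues
  of \<open>B\<close>, counted with multiplicity: what remains of the spectrum, on the orthogonal
  complement of the columns, lies below the selected eigenvalues. (This is meant for
  self-adjoint \<open>B\<close> of finite rank, which have an orthonormal eigenbasis on that complement.)
  The columns come in any order, and ties between equal eigenvalues may be resolved in any way.
\<close>

definition top_eigenvectors ::
  "nat \<Rightarrow> ('h::real_inner \<Rightarrow> 'h) \<Rightarrow> (nat \<Rightarrow> 'h) \<Rightarrow> bool" where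
  "top_eigenvectors K B U \<longleftrightarrow>
     orthonormal_columns K U \<and>
     (\<exists>l :: nat \<Rightarrow> real.
        (\<forall>i<K. B (U i) = l i *\<^sub>R U i) \<and>
        (\<forall>v \<mu>. v \<noteq> 0 \<longrightarrow> B v = \<mu> *\<^sub>R v \<longrightarrow> (\<forall>i<K. U i \<bullet> v = 0) \<longrightarrow> (\<forall>i<K. \<mu> \<le> l i)))"

end

theory Submission
  imports Defs
begin

text \<open>
  The operator norm of a projection depends only on its rank, so the penalty is constant and only
  the trace of \<open>M B\<close> matters, where \<open>B\<close> is the class operator. Being a symmetrized product of two
  vectors, \<open>B\<close> is \<open>e e\<^sup>T - f f\<^sup>T\<close> with \<open>e\<close> orthogonal to \<open>f\<close>, and the trace is
  \<open>\<parallel>M e\<parallel>\<^sup>2 - \<parallel>M f\<parallel>\<^sup>2\<close>. For \<open>K > 0\<close> it is maximal exactly when \<open>M\<close> fixes \<open>e\<close> and annihilates \<open>f\<close>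
  (or \<open>M\<close> is the identity, if \<open>K\<close> is the dimension of the space), and these are exactly the
  projections onto top eigenvectors.
\<close>

section \<open>Orthogonal projections given by orthonormal columns\<close>

lemma orthonormal_columnsD:
  assumes "orthonormal_columns K P" "i < K" "j < K"
  shows "P i \<bullet> P j = (if i = j then 1 else 0)"
  using assms by (auto simp: orthonormal_columns_def)

lemma inner_PPt: "u \<bullet> PPt K P v = (\<Sum>i<K. (P i \<bullet> u) * (P i \<bullet> v))"
  by (simp add: PPt_def inner_sum_right inner_commute mult.commute)

lemma PPt_sym: "u \<bullet> PPt K P v = PPt K P u \<bullet> v"
  by (subst (2) inner_commute) (simp add: inner_PPt mult.commute)

lemma bounded_linear_PPt: "bounded_linear (PPt K P)"
  unfolding PPt_def [abs_def]
  by (intro bounded_linear_sum bounded_linear_compose[OF bounded_linear_scaleR_left bounded_linear_inner_right])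

lemma linear_PPt: "linear (PPt K P)"
  by (rule bounded_linear.linear[OF bounded_linear_PPt])

lemma inner_column_PPt:
  assumes "orthonormal_columns K P" "i < K"
  shows "P i \<bullet> PPt K P v = P i \<bullet> v"
proof -
  have "P i \<bullet> PPt K P v = (\<Sum>j<K. (if j = i then 1 else 0) * (P j \<bullet> v))"
    unfolding inner_PPt using assms
    by (intro sum.cong) (auto simp: orthonormal_columnsD)
  also have "\<dots> = P i \<bullet> v"
    using assms(2) by (simp add: if_distrib[of "\<lambda>x. x * _"] cong: if_cong)
  finally show ?thesis .
qed

lemma PPt_idem:
  assumes "orthonormal_columns K P"
  shows "PPt K P (PPt K P v) = PPt K P v"
proof -
  have "PPt K P (PPt K P v) = (\<Sum>i<K. (P i \<bullet> PPt K P v) *\<^sub>R P i)"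
    by (rule PPt_def)
  also have "\<dots> = PPt K P v"
    using inner_column_PPt[OF assms] by (subst (2) PPt_def) (intro sum.cong; simp)
  finally show ?thesis .
qed

lemma PPt_eq_0: "(\<And>i. i < K \<Longrightarrow> P i \<bullet> v = 0) \<Longrightarrow> PPt K P v = 0"
  by (simp add: PPt_def)

lemma PPt_column:
  assumes "orthonormal_columns K P" "i < K"
  shows "PPt K P (P i) = P i"
proof -
  have "PPt K P (P i) = (\<Sum>j<K. if j = i then P i else 0)"
    unfolding PPt_def using assms
    by (intro sum.cong) (auto simp: orthonormal_columnsD)
  also have "\<dots> = P i" using assms(2) by simp
  finally show ?thesis .
qed

lemma inner_PPt_self:
  assumes "orthonormal_columns K P"
  shows "v \<bullet> PPt K P v = (norm (PPt K P v))\<^sup>2"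
  by (metis PPt_idem[OF assms] PPt_sym power2_norm_eq_inner)

lemma norm_diff_PPt:
  assumes "orthonormal_columns K P"
  shows "(norm (v - PPt K P v))\<^sup>2 = (norm v)\<^sup>2 - (norm (PPt K P v))\<^sup>2"
  using inner_PPt_self[OF assms, of v]
  by (simp add: power2_norm_eq_inner inner_diff inner_commute)

lemma norm_PPt_le:
  assumes "orthonormal_columns K P"
  shows "norm (PPt K P v) \<le> norm v"
  using norm_diff_PPt[OF assms, of v]
  by (metis diff_ge_0_iff_ge norm_ge_zero power2_le_imp_le zero_le_power2)

text \<open>The equality case of Pythagoras: a projection that does not shorten a vector leaves no
  remainder.\<close>

lemma PPt_fixed:
  assumes "orthonormal_columns K P" "(norm v)\<^sup>2 \<le> (norm (PPt K P v))\<^sup>2"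
  shows "PPt K P v = v"
proof -
  have "(norm (v - PPt K P v))\<^sup>2 \<le> 0"
    using norm_diff_PPt[OF assms(1), of v] assms(2) by linarith
  then show ?thesis by simp
qed

lemma inner_column_sq_le:
  assumes "i < K"
  shows "(P i \<bullet> v)\<^sup>2 \<le> v \<bullet> PPt K P v"
  unfolding inner_PPt power2_eq_square using assms
  by (intro member_le_sum) auto

text \<open>A single coefficient bounds the length of the projection from below, so an estimate for
  one column is enough to place \<open>v\<close> in the span.\<close>

lemma PPt_fixed_column:
  assumes "orthonormal_columns K P" "i < K" "(norm v)\<^sup>2 \<le> (P i \<bullet> v)\<^sup>2"
  shows "PPt K P v = v"
  using assms(3) inner_column_sq_le[OF assms(2), of P v] inner_PPt_self[OF assms(1), of v]
  by (intro PPt_fixed[OF assms(1)]) linarith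

lemma onorm_PPt:
  assumes "orthonormal_columns K P"
  shows "onorm (PPt K P) = (if K = 0 then 0 else 1)"
proof (cases "K = 0")
  case True
  then have "PPt K P = (\<lambda>v. 0)" by (simp add: PPt_def fun_eq_iff)
  then show ?thesis using True by (simp add: onorm_zero)
next
  case False
  have "onorm (PPt K P) \<le> 1"
    using norm_PPt_le[OF assms] by (intro onorm_bound) auto
  moreover have "norm (PPt K P (P 0)) \<le> onorm (PPt K P) * norm (P 0)"
    by (rule onorm[OF bounded_linear_PPt])
  moreover have "norm (P 0) = 1"
    using orthonormal_columnsD[OF assms, of 0 0] False by (simp add: norm_eq_1)
  moreover have "PPt K P (P 0) = P 0"
    using PPt_column[OF assms] False by simp
  ultimately show ?thesis using False by simp
qed

section \<open>Exchange and dimension arguments for orthonormal columns\<close>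

lemma orthonormal_columns_0 [simp]: "orthonormal_columns 0 P"
  by (simp add: orthonormal_columns_def)

lemma orthonormal_columns_upd:
  assumes "orthonormal_columns m T" "norm v = 1" "\<And>i. i < m \<Longrightarrow> T i \<bullet> v = 0"
  shows "orthonormal_columns (Suc m) (T(m := v))"
  using assms
  by (auto simp: orthonormal_columns_def less_Suc_eq norm_eq_1 inner_commute)

text \<open>
  The trace of the product of the two projections is at most \<open>m\<close>, so the projection of rank
  \<open>m\<close> cannot fix all \<open>n\<close> columns of \<open>Q\<close>.
\<close>

lemma exists_orthonormal_step:
  fixes T Q :: "nat \<Rightarrow> 'h::real_inner"
  assumes T: "orthonormal_columns m T" and Q: "orthonormal_columns n Q" and "m < n"
  obtains v where "norm v = 1" "\<And>i. i < m \<Longrightarrow> T i \<bullet> v = 0"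
    "\<And>x. (\<And>i. i < m \<Longrightarrow> T i \<bullet> x = 0) \<Longrightarrow> (\<And>i. i < n \<Longrightarrow> Q i \<bullet> x = 0) \<Longrightarrow> v \<bullet> x = 0"
proof -
  have "\<exists>i<n. PPt m T (Q i) \<noteq> Q i"
  proof (rule ccontr)
    assume "\<not> ?thesis"
    then have fix_Q: "PPt m T (Q i) = Q i" if "i < n" for i using that by blast
    have "real n = (\<Sum>i<n. Q i \<bullet> PPt m T (Q i))"
      using orthonormal_columnsD[OF Q] by (simp add: fix_Q)
    also have "\<dots> = (\<Sum>j<m. T j \<bullet> PPt n Q (T j))"
      unfolding inner_PPt by (subst sum.swap) (simp add: inner_commute)
    also have "\<dots> \<le> (\<Sum>j<m. 1)"
    proof (rule sum_mono)
      fix j assume "j \<in> {..<m}"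
      then have "norm (T j) = 1"
        using orthonormal_columnsD[OF T, of j j] by (simp add: norm_eq_1)
      then show "T j \<bullet> PPt n Q (T j) \<le> 1"
        unfolding inner_PPt_self[OF Q] using norm_PPt_le[OF Q, of "T j"]
        by (simp add: power_le_one)
    qed
    finally show False using \<open>m < n\<close> by simp
  qed
  then obtain i where i: "i < n" "PPt m T (Q i) \<noteq> Q i" by blast
  \<comment> \<open>The remainder \<open>u\<close> is a combination of columns of both systems, so
    whatever is orthogonal to both is orthogonal to \<open>u\<close>.\<close>
  define u where "u = Q i - PPt m T (Q i)"
  have "u \<noteq> 0" using i by (simp add: u_def)
  have "T j \<bullet> u = 0" if "j < m" for j
    using inner_column_PPt[OF T that] by (simp add: u_def inner_diff_right)
  moreover have "u \<bullet> x = 0"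
    if "\<And>j. j < m \<Longrightarrow> T j \<bullet> x = 0" "\<And>j. j < n \<Longrightarrow> Q j \<bullet> x = 0" for x
    using that i(1) PPt_sym[of "Q i" m T x] PPt_eq_0[of m T x]
    by (simp add: u_def inner_diff_left)
  ultimately show thesis
    using \<open>u \<noteq> 0\<close> by (intro that[of "sgn u"]) (auto simp: norm_sgn sgn_div_norm)
qed

text \<open>Steinitz exchange, one vector at a time. The last conclusion says without spans that
  \<open>U\<close> stays inside the span of \<open>T\<close> and \<open>Q\<close>, since a
  finite-dimensional subspace is its own double orthogonal complement.\<close>

lemma orthonormal_extension:
  fixes T Q :: "nat \<Rightarrow> 'h::real_inner"
  assumes T: "orthonormal_columns m T" and Q: "orthonormal_columns n Q" and "m \<le> n"
  obtains U where "orthonormal_columns n U" "\<And>i. i < m \<Longrightarrow> U i = T i"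
    "\<And>x i. (\<And>i. i < m \<Longrightarrow> T i \<bullet> x = 0) \<Longrightarrow> (\<And>i. i < n \<Longrightarrow> Q i \<bullet> x = 0) \<Longrightarrow> i < n \<Longrightarrow> U i \<bullet> x = 0"
proof -
  have "\<exists>U. orthonormal_columns (m + k) U \<and> (\<forall>i<m. U i = T i) \<and>
    (\<forall>x. (\<forall>i<m. T i \<bullet> x = 0) \<longrightarrow> (\<forall>i<n. Q i \<bullet> x = 0) \<longrightarrow> (\<forall>i<m+k. U i \<bullet> x = 0))"
    if "m + k \<le> n" for k
    using that
  proof (induction k)
    case 0
    then show ?case using T by (intro exI[of _ T]) auto
  next
    case (Suc k)
    then obtain U where U: "orthonormal_columns (m + k) U" "\<forall>i<m. U i = T i"
      "\<forall>x. (\<forall>i<m. T i \<bullet> x = 0) \<longrightarrow> (\<forall>i<n. Q i \<bullet> x = 0) \<longrightarrow> (\<forall>i<m+k. U i \<bullet> x = 0)"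
      by auto
    have "m + k < n" using Suc.prems by simp
    from exists_orthonormal_step[OF U(1) Q this] obtain v where v: "norm v = 1"
      "\<And>i. i < m + k \<Longrightarrow> U i \<bullet> v = 0"
      "\<And>x. (\<And>i. i < m + k \<Longrightarrow> U i \<bullet> x = 0) \<Longrightarrow> (\<And>i. i < n \<Longrightarrow> Q i \<bullet> x = 0) \<Longrightarrow> v \<bullet> x = 0"
      by metis
    have "orthonormal_columns (m + Suc k) (U(m + k := v))"
      using orthonormal_columns_upd[OF U(1) v(1,2)] by simp
    moreover have "\<forall>i<m. (U(m + k := v)) i = T i" using U(2) by simp
    moreover have "\<forall>x. (\<forall>i<m. T i \<bullet> x = 0) \<longrightarrow> (\<forall>i<n. Q i \<bullet> x = 0) \<longrightarrow>
        (\<forall>i<m + Suc k. (U(m + k := v)) i \<bullet> x = 0)"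
      using U(3) v(3) by (auto simp: less_Suc_eq)
    ultimately show ?case by blast
  qed
  from this[of "n - m"] \<open>m \<le> n\<close> show thesis by (auto intro: that)
qed

text \<open>Otherwise the exchange step yields a unit vector orthogonal to \<open>P\<close> and
  hence to \<open>T\<close>, which lies in the span of \<open>P\<close>. Coming from these two
  systems, it would be orthogonal to itself.\<close>

lemma orthonormal_columns_le:
  assumes T: "orthonormal_columns m T" and P: "orthonormal_columns K P"
    and "\<And>i. i < m \<Longrightarrow> PPt K P (T i) = T i"
  shows "m \<le> K"
proof (rule ccontr)
  assume "\<not> m \<le> K"
  then have "K < m" by simp
  from exists_orthonormal_step[OF P T this] obtain v where v: "norm v = 1"
    "\<And>i. i < K \<Longrightarrow> P i \<bullet> v = 0"
    "\<And>x. (\<And>i. i < K \<Longrightarrow> P i \<bullet> x = 0) \<Longrightarrow> (\<And>i. i < m \<Longrightarrow> T i \<bullet> x = 0) \<Longrightarrow> v \<bullet> x = 0"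
    by metis
  have "T i \<bullet> v = 0" if "i < m" for i
    using assms(3)[OF that] PPt_sym[of "T i" K P v] PPt_eq_0[of K P v, OF v(2)] by simp
  then have "v \<bullet> v = 0" using v by blast
  then show False using v(1) by simp
qed

text \<open>A dimension count: a vector in the range of \<open>PPt K P\<close> not reached by
  \<open>U\<close> would extend \<open>U\<close> to \<open>Suc K\<close> orthonormal vectors fixed
  by \<open>PPt K P\<close>.\<close>

lemma PPt_eqI:
  assumes U: "orthonormal_columns K U" and P: "orthonormal_columns K P"
    and UP: "\<And>i. i < K \<Longrightarrow> PPt K P (U i) = U i"
  shows "PPt K U = PPt K P"
proof -
  have range_U: "PPt K P (PPt K U v) = PPt K U v" for v
    unfolding PPt_def[of K U] by (simp add: linear_sum[OF linear_PPt] linear_cmul[OF linear_PPt] UP)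
  have *: "PPt K U (PPt K P v) = PPt K P v" for v
  proof (rule ccontr)
    assume "PPt K U (PPt K P v) \<noteq> PPt K P v"
    define x where "x = PPt K P v - PPt K U (PPt K P v)"
    have "x \<noteq> 0" using \<open>_ \<noteq> _\<close> by (simp add: x_def)
    have "PPt K P x = x"
      by (simp add: x_def linear_diff[OF linear_PPt] PPt_idem[OF P] range_U)
    have "U i \<bullet> x = 0" if "i < K" for i
      using inner_column_PPt[OF U that] by (simp add: x_def inner_diff_right)
    then have "orthonormal_columns (Suc K) (U(K := sgn x))"
      using \<open>x \<noteq> 0\<close> by (intro orthonormal_columns_upd U) (auto simp: norm_sgn sgn_div_norm)
    then have "Suc K \<le> K"
      using P by (rule orthonormal_columns_le)
        (auto simp: less_Suc_eq UP sgn_div_norm linear_cmul[OF linear_PPt] \<open>PPt K P x = x\<close>)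
    then show False by simp
  qed
  show ?thesis
  proof
    fix v
    \<comment> \<open>Each projection fixes the range of the other; self-adjointness turns these two
      facts into equality.\<close>
    have "u \<bullet> PPt K U v = u \<bullet> PPt K P v" for u
      by (metis * PPt_sym range_U)
    then show "PPt K U v = PPt K P v" by (metis vector_eq_rdot inner_commute)
  qed
qed

section \<open>Top eigenvectors of the signed form\<close>

text \<open>The last disjunct is the case where \<open>K\<close> is the dimension of the whole space.\<close>

definition captures :: "nat \<Rightarrow> 'h::real_inner \<Rightarrow> 'h \<Rightarrow> ('h \<Rightarrow> 'h) \<Rightarrow> bool" where
  "captures K e f M \<longleftrightarrow> K = 0 \<or> M e = e \<and> (M f = 0 \<or> M = (\<lambda>v. v))"

definition signed_form :: "'h::real_inner \<Rightarrow> 'h \<Rightarrow> 'h \<Rightarrow> 'h" where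
  "signed_form e f v = (e \<bullet> v) *\<^sub>R e - (f \<bullet> v) *\<^sub>R f"

text \<open>Maximality is tested on remainders \<open>v - PPt K U v\<close>. A remainder of
  \<open>e\<close> would have an eigenvalue too large to be left out. A column that meets
  \<open>f\<close> has a negative eigenvalue unless \<open>f = 0\<close>, which is admissible only
  if nothing remains outside the span.\<close>

lemma captures_if_top_eigenvectors:
  assumes "e \<bullet> f = 0" and top: "top_eigenvectors K (signed_form e f) U"
  shows "captures K e f (PPt K U)"
proof (cases "K = 0")
  case False
  from top obtain l where U: "orthonormal_columns K U"
    and l: "\<And>i. i < K \<Longrightarrow> signed_form e f (U i) = l i *\<^sub>R U i"
    and max: "\<And>v \<mu> i. v \<noteq> 0 \<Longrightarrow> signed_form e f v = \<mu> *\<^sub>R v \<Longrightarrow> (\<And>i. i < K \<Longrightarrow> U i \<bullet> v = 0)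
      \<Longrightarrow> i < K \<Longrightarrow> \<mu> \<le> l i"
    unfolding top_eigenvectors_def by metis
  have l_eq: "l i = (e \<bullet> U i)\<^sup>2 - (f \<bullet> U i)\<^sup>2" if "i < K" for i
  proof -
    have "l i = U i \<bullet> signed_form e f (U i)"
      using l[OF that] orthonormal_columnsD[OF U that that] by simp
    then show ?thesis
      by (simp add: signed_form_def inner_diff_right inner_commute power2_eq_square)
  qed
  have e_l: "(e \<bullet> e) * (e \<bullet> U i) = l i * (e \<bullet> U i)" if "i < K" for i
    using arg_cong[OF l[OF that], of "inner e"] \<open>e \<bullet> f = 0\<close>
    by (simp add: signed_form_def inner_diff_right mult.commute)
  have f_l: "- (f \<bullet> f) * (f \<bullet> U i) = l i * (f \<bullet> U i)" if "i < K" for i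
    using arg_cong[OF l[OF that], of "inner f"] \<open>e \<bullet> f = 0\<close>
    by (simp add: signed_form_def inner_diff_right inner_commute mult.commute)
  have perp: "U i \<bullet> (v - PPt K U v) = 0" if "i < K" for i v
    using inner_column_PPt[OF U that] by (simp add: inner_diff_right)
  \<comment> \<open>The form is self-adjoint and the columns are its eigenvectors, so the remainder
    of an eigenvector is zero or again an eigenvector for the same eigenvalue.\<close>
  have commute: "signed_form e f (PPt K U v) = PPt K U (signed_form e f v)" for v
  proof -
    have "signed_form e f (PPt K U v) = (\<Sum>i<K. (U i \<bullet> v) *\<^sub>R signed_form e f (U i))"
      by (simp add: signed_form_def PPt_def inner_sum_right scaleR_sum_left sum_subtractf
          scaleR_right_diff_distrib)
    also have "\<dots> = (\<Sum>i<K. (U i \<bullet> signed_form e f v) *\<^sub>R U i)"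
    proof (rule sum.cong)
      fix i assume "i \<in> {..<K}"
      moreover have "U i \<bullet> signed_form e f v = signed_form e f (U i) \<bullet> v"
        by (simp add: signed_form_def inner_diff inner_commute)
      ultimately show "(U i \<bullet> v) *\<^sub>R signed_form e f (U i) = (U i \<bullet> signed_form e f v) *\<^sub>R U i"
        by (simp add: l mult.commute)
    qed simp
    finally show ?thesis by (simp add: PPt_def)
  qed
  have form_e: "signed_form e f e = (e \<bullet> e) *\<^sub>R e" and form_f: "signed_form e f f = - (f \<bullet> f) *\<^sub>R f"
    using \<open>e \<bullet> f = 0\<close> by (simp_all add: signed_form_def inner_commute)
  have form_diff: "signed_form e f (u - v) = signed_form e f u - signed_form e f v" for u v
    by (simp add: signed_form_def algebra_simps inner_diff_right)
  have Pe: "PPt K U e = e"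
  proof (rule ccontr)
    assume "PPt K U e \<noteq> e"
    then have "e - PPt K U e \<noteq> 0" by simp
    moreover have "signed_form e f (e - PPt K U e) = (e \<bullet> e) *\<^sub>R (e - PPt K U e)"
      by (simp add: form_diff commute form_e linear_cmul[OF linear_PPt] algebra_simps)
    ultimately have "e \<bullet> e \<le> l 0" using max[of "e - PPt K U e" "e \<bullet> e" 0] perp False by blast
    \<comment> \<open>Dropping the negative term of \<open>l_eq\<close> shows that the single column
      \<open>U 0\<close> carries the whole length of \<open>e\<close>.\<close>
    also have "l 0 \<le> (e \<bullet> U 0)\<^sup>2" using l_eq False by simp
    finally have "PPt K U e = e"
      using False by (intro PPt_fixed_column[OF U, of 0]) (auto simp: power2_norm_eq_inner inner_commute)
    with \<open>PPt K U e \<noteq> e\<close> show False by simp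
  qed
  have "PPt K U v = v" if "PPt K U f \<noteq> 0" for v
  proof (rule ccontr)
    assume "PPt K U v \<noteq> v"
    define x where "x = v - PPt K U v"
    have "x \<noteq> 0" using \<open>_ \<noteq> v\<close> by (simp add: x_def)
    from that obtain i where i: "i < K" "U i \<bullet> f \<noteq> 0" using PPt_eq_0 by blast
    \<comment> \<open>A column that meets \<open>f\<close> must share its eigenvalue, because
      \<open>f_l\<close> can be cancelled.\<close>
    then have li: "l i = - (f \<bullet> f)" using f_l[OF i(1)] by (metis inner_commute mult_right_cancel)
    have "f \<bullet> f \<le> (U i \<bullet> f)\<^sup>2" using l_eq[OF i(1)] li
      by (smt (verit) inner_commute zero_le_power2)
    then have Pf: "PPt K U f = f"
      using i by (intro PPt_fixed_column[OF U, of i]) (auto simp: power2_norm_eq_inner)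
    have "PPt K U x = 0" using perp by (intro PPt_eq_0) (simp add: x_def)
    then have "e \<bullet> x = 0" "f \<bullet> x = 0"
      using Pe Pf PPt_sym[of e K U x] PPt_sym[of f K U x] by auto
    \<comment> \<open>With \<open>e\<close> and \<open>f\<close> both in the span, the remainder
      \<open>x\<close> is an eigenvector for 0, which must not exceed
      \<open>l i = - (f \<bullet> f)\<close>.\<close>
    then have "signed_form e f x = 0 *\<^sub>R x" by (simp add: signed_form_def)
    then have "0 \<le> l i" using max[of x 0 i] \<open>x \<noteq> 0\<close> perp i(1) by (simp add: x_def)
    then have "f = 0" using li by (metis inner_gt_zero_iff neg_0_le_iff_le not_le)
    then show False using i by simp
  qed
  then show ?thesis using Pe by (auto simp: captures_def)
qed (simp add: captures_def)

text \<open>Zero vectors are discarded before normalizing, so \<open>m\<close> counts the nonzero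
  ones. The last property expresses that \<open>e\<close> and \<open>g\<close> lie in the span of
  \<open>T\<close>.\<close>

lemma orthonormal_pair:
  fixes e g :: "'h::real_inner"
  assumes "e \<bullet> g = 0"
  obtains m T where "orthonormal_columns m T"
    "\<And>i. i < m \<Longrightarrow> T i = sgn e \<or> T i = sgn g"
    "\<And>v. (\<And>i. i < m \<Longrightarrow> T i \<bullet> v = 0) \<Longrightarrow> e \<bullet> v = 0 \<and> g \<bullet> v = 0"
proof -
  have sgn: "norm (sgn u) = 1" "sgn u \<bullet> v = 0 \<longleftrightarrow> u \<bullet> v = 0" if "u \<noteq> 0" for u v :: 'h
    using that by (auto simp: norm_sgn sgn_div_norm)
  have one: "orthonormal_columns (Suc 0) (\<lambda>_. sgn u)" if "u \<noteq> 0" for u :: 'h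
    using sgn[OF that] by (auto simp: orthonormal_columns_def norm_eq_1)
  consider "e = 0" "g = 0" | "e = 0" "g \<noteq> 0" | "e \<noteq> 0" "g = 0" | "e \<noteq> 0" "g \<noteq> 0" by blast
  then show thesis
  proof cases
    case 1
    then show thesis by (intro that[of 0]) auto
  next
    case 2
    then show thesis using one sgn by (intro that[of "Suc 0" "\<lambda>_. sgn g"]) auto
  next
    case 3
    then show thesis using one sgn by (intro that[of "Suc 0" "\<lambda>_. sgn e"]) auto
  next
    case 4
    have "orthonormal_columns (Suc (Suc 0)) ((\<lambda>_. sgn e)(Suc 0 := sgn g))"
      using assms sgn 4 by (intro orthonormal_columns_upd one) (auto simp: sgn_div_norm)
    then show thesis
    proof (rule that)
      fix v assume *: "\<And>i. i < Suc (Suc 0) \<Longrightarrow> ((\<lambda>_. sgn e)(Suc 0 := sgn g)) i \<bullet> v = 0"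
      show "e \<bullet> v = 0 \<and> g \<bullet> v = 0"
        using *[of 0] *[of 1] sgn 4 by auto
    qed auto
  qed
qed

text \<open>The subspace gets a new basis that starts with the normalized \<open>e\<close> and, if
  it lies in the subspace, \<open>f\<close>; on the rest of the subspace the form vanishes.\<close>

lemma eigenvector_columns:
  assumes "e \<bullet> f = 0" and P: "orthonormal_columns K P" and "captures K e f (PPt K P)"
  obtains U where "orthonormal_columns K U" "PPt K U = PPt K P"
    "\<And>i. i < K \<Longrightarrow> \<exists>l. signed_form e f (U i) = l *\<^sub>R U i"
proof (cases "K = 0")
  case True
  then show thesis using that[of P] P by auto
next
  case False
  \<comment> \<open>The part of \<open>f\<close> inside the subspace: zero if \<open>f\<close> is
    annihilated, \<open>f\<close> itself if the projection is the identity. Inner products with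
    vectors of the subspace do not distinguish \<open>f\<close> from \<open>g\<close>.\<close>
  define g where "g = PPt K P f"
  have Pe: "PPt K P e = e" and g: "g = 0 \<or> g = f"
    using assms(3) False by (auto simp: captures_def g_def)
  have Pg: "PPt K P g = g" by (simp add: g_def PPt_idem[OF P])
  have "e \<bullet> g = 0" using assms(1) g by auto
  then obtain m T where T: "orthonormal_columns m T"
    "\<And>i. i < m \<Longrightarrow> T i = sgn e \<or> T i = sgn g"
    "\<And>v. (\<And>i. i < m \<Longrightarrow> T i \<bullet> v = 0) \<Longrightarrow> e \<bullet> v = 0 \<and> g \<bullet> v = 0"
    by (rule orthonormal_pair) blast
  have PT: "PPt K P (T i) = T i" if "i < m" for i
    using T(2)[OF that] Pe Pg by (auto simp: sgn_div_norm linear_cmul[OF linear_PPt])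
  have "m \<le> K" using T(1) P PT by (rule orthonormal_columns_le)
  from orthonormal_extension[OF T(1) P this] obtain U where U: "orthonormal_columns K U"
    "\<And>i. i < m \<Longrightarrow> U i = T i"
    "\<And>x i. (\<And>i. i < m \<Longrightarrow> T i \<bullet> x = 0) \<Longrightarrow> (\<And>i. i < K \<Longrightarrow> P i \<bullet> x = 0) \<Longrightarrow> i < K \<Longrightarrow> U i \<bullet> x = 0"
    by metis
  have PU: "PPt K P (U i) = U i" if "i < K" for i
  proof -
    \<comment> \<open>This remainder is orthogonal to \<open>P\<close>, hence to \<open>T\<close>,
      hence by the extension property to \<open>U i\<close>, and so to itself.\<close>
    define x where "x = U i - PPt K P (U i)"
    have Px: "P j \<bullet> x = 0" if "j < K" for j
      using inner_column_PPt[OF P that] by (simp add: x_def inner_diff_right)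
    then have "PPt K P x = 0" by (rule PPt_eq_0)
    then have "T j \<bullet> x = 0" if "j < m" for j
      using PT[OF that] PPt_sym[of "T j" K P x] by simp
    then have "U i \<bullet> x = 0" using Px \<open>i < K\<close> by (rule U(3))
    moreover have "PPt K P (U i) \<bullet> x = 0" using \<open>PPt K P x = 0\<close> PPt_sym[of "U i" K P x] by simp
    ultimately have "x \<bullet> x = 0" by (simp add: x_def inner_diff_left)
    then show ?thesis by (simp add: x_def)
  qed
  have fU: "f \<bullet> U i = g \<bullet> U i" if "i < K" for i
    using PU[OF that] PPt_sym[of f K P "U i"] by (simp add: g_def)
  have form_U: "signed_form e f (U i) = (e \<bullet> U i) *\<^sub>R e - (g \<bullet> U i) *\<^sub>R g" if "i < K" for i
    using fU[OF that] g by (auto simp: signed_form_def)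
  have "\<exists>l. signed_form e f (U i) = l *\<^sub>R U i" if "i < K" for i
  proof (cases "i < m")
    case True
    have cases: "U i = sgn e \<or> U i = sgn g" using T(2) U(2) True by simp
    then show ?thesis
    proof
      assume "U i = sgn e"
      then have "signed_form e f (U i) = (e \<bullet> e) *\<^sub>R U i"
        using form_U[OF that] \<open>e \<bullet> g = 0\<close> by (simp add: sgn_div_norm inner_commute)
      then show ?thesis ..
    next
      assume "U i = sgn g"
      then have "signed_form e f (U i) = - (g \<bullet> g) *\<^sub>R U i"
        using form_U[OF that] \<open>e \<bullet> g = 0\<close> by (simp add: sgn_div_norm inner_commute)
      then show ?thesis ..
    qed
  next
    case False
    have "T j \<bullet> U i = 0" if "j < m" for j
      using orthonormal_columnsD[OF U(1), of j i] U(2)[OF that] False that \<open>i < K\<close> \<open>m \<le> K\<close> by auto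
    then have "e \<bullet> U i = 0 \<and> g \<bullet> U i = 0" by (rule T(3))
    then have "signed_form e f (U i) = 0 *\<^sub>R U i" using form_U[OF that] by simp
    then show ?thesis ..
  qed
  with U(1) PPt_eqI[OF U(1) P PU] show thesis by (rule that)
qed

text \<open>Zero separates the eigenvalues. If some eigenvector is left over, the projection is not
  the identity, so it annihilates \<open>f\<close> and the selected eigenvalues are squares; a
  leftover eigenvector is orthogonal to \<open>e\<close>, so only the negative term acts on
  it.\<close>

lemma top_eigenvectors_if_captures:
  assumes "e \<bullet> f = 0" and P: "orthonormal_columns K P" and cap: "captures K e f (PPt K P)"
  obtains U where "top_eigenvectors K (signed_form e f) U" "PPt K U = PPt K P"
proof -
  from eigenvector_columns[OF assms] obtain U where U: "orthonormal_columns K U"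
    and UP: "PPt K U = PPt K P"
    and ev: "\<And>i. i < K \<Longrightarrow> \<exists>l. signed_form e f (U i) = l *\<^sub>R U i"
    by metis
  from ev obtain l where l: "\<And>i. i < K \<Longrightarrow> signed_form e f (U i) = l i *\<^sub>R U i" by metis
  have "\<mu> \<le> l i"
    if v: "v \<noteq> 0" "signed_form e f v = \<mu> *\<^sub>R v" "\<And>i. i < K \<Longrightarrow> U i \<bullet> v = 0" and i: "i < K" for v \<mu> i
  proof -
    have Pv: "PPt K P v = 0" using v(3) by (simp add: UP[symmetric] PPt_eq_0)
    with v(1) have "PPt K P \<noteq> (\<lambda>v. v)" by auto
    then have Pe: "PPt K P e = e" and Pf: "PPt K P f = 0"
      using cap i by (auto simp: captures_def)
    have "f \<bullet> U i = 0"
      using Pf PPt_column[OF U i] PPt_sym[of f K P "U i"] UP by simp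
    then have "l i = (e \<bullet> U i)\<^sup>2"
      using arg_cong[OF l[OF i], of "inner (U i)"] orthonormal_columnsD[OF U i i]
      by (simp add: signed_form_def inner_commute power2_eq_square)
    moreover have "e \<bullet> v = 0" using Pe Pv PPt_sym[of e K P v] by simp
    then have "\<mu> * (v \<bullet> v) = - (f \<bullet> v)\<^sup>2"
      using arg_cong[OF v(2), of "inner v"]
      by (simp add: signed_form_def inner_commute power2_eq_square)
    then have "\<mu> * (v \<bullet> v) \<le> 0" by simp
    then have "\<mu> \<le> 0" using v(1) by (metis inner_gt_zero_iff mult_le_0_iff not_le)
    ultimately show ?thesis by (smt (verit) zero_le_power2)
  qed
  then have "top_eigenvectors K (signed_form e f) U"
    unfolding top_eigenvectors_def using U l by blast
  then show thesis using UP by (rule that)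
qed

text \<open>Unless \<open>P0\<close> spans the whole space, there is room for \<open>Suc K\<close>
  orthonormal vectors, hence for \<open>K\<close> of them orthogonal to \<open>f\<close>. Exchanging
  one for \<open>e\<close> keeps them orthogonal to \<open>f\<close>.\<close>

lemma exists_captures:
  fixes e f :: "'h::real_inner"
  assumes "e \<bullet> f = 0" and P0: "orthonormal_columns K (P0 :: nat \<Rightarrow> 'h)"
  obtains P where "orthonormal_columns K P" "captures K e f (PPt K P)"
proof (cases "K = 0 \<or> PPt K P0 = (\<lambda>v. v)")
  case True
  then show thesis using P0 by (intro that[of P0]) (auto simp: captures_def)
next
  case False
  then obtain v where v: "PPt K P0 v \<noteq> v" by auto
  have Q: "orthonormal_columns (Suc K) (P0(K := sgn (v - PPt K P0 v)))"
    using v inner_column_PPt[OF P0]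
    by (intro orthonormal_columns_upd P0) (auto simp: norm_sgn sgn_div_norm inner_diff_right)
  have one: "orthonormal_columns (Suc 0) (\<lambda>_. sgn u)" if "u \<noteq> 0" for u :: 'h
    using that by (auto simp: orthonormal_columns_def norm_eq_1[symmetric] norm_sgn)
  obtain R where R: "orthonormal_columns K R" "\<And>i. i < K \<Longrightarrow> R i \<bullet> f = 0"
  proof (cases "f = 0")
    case True
    then show thesis using P0 by (intro that[of P0]) auto
  next
    case False
    \<comment> \<open>Starting a system of \<open>Suc K\<close> vectors with \<open>sgn f\<close>
      and dropping that first column leaves \<open>K\<close> columns orthogonal to
      \<open>f\<close>.\<close>
    from orthonormal_extension[OF one[OF False] Q] obtain V where
      V: "orthonormal_columns (Suc K) V" "V 0 = sgn f"
      by (metis Suc_le_mono le0 lessI)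
    have "V (Suc i) \<bullet> f = 0" if "i < K" for i
      using orthonormal_columnsD[OF V(1), of "Suc i" 0] V(2) that False by (simp add: sgn_div_norm)
    moreover have "orthonormal_columns K (\<lambda>i. V (Suc i))"
      using V(1) by (auto simp: orthonormal_columns_def)
    ultimately show thesis by (rule that[rotated])
  qed
  show thesis
  proof (cases "e = 0")
    case True
    then show thesis using R
      by (intro that[of R]) (auto simp: captures_def PPt_eq_0 linear_0[OF linear_PPt])
  next
    case e: False
    have "Suc 0 \<le> K" using False by simp
    from orthonormal_extension[OF one[OF e] R(1) this] obtain U where
      U: "orthonormal_columns K U" "U 0 = sgn e"
      "\<And>x i. (\<And>i. i < Suc 0 \<Longrightarrow> sgn e \<bullet> x = 0) \<Longrightarrow> (\<And>i. i < K \<Longrightarrow> R i \<bullet> x = 0)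
        \<Longrightarrow> i < K \<Longrightarrow> U i \<bullet> x = 0"
      by (metis lessI)
    have "U i \<bullet> f = 0" if "i < K" for i
      using U(3)[of f i] R(2) that assms(1) by (simp add: sgn_div_norm)
    then have "PPt K U f = 0" by (rule PPt_eq_0)
    moreover have "U 0 \<bullet> e = norm e"
      using e by (simp add: U(2) sgn_div_norm power2_norm_eq_inner[symmetric] power2_eq_square)
    then have "PPt K U e = e"
      using False by (intro PPt_fixed_column[OF U(1), of 0]) auto
    ultimately show thesis using U(1) by (intro that[of U]) (auto simp: captures_def)
  qed
qed

section \<open>Maximizers of the trace\<close>

text \<open>For \<open>M = P P\<^sup>T\<close>, the trace of \<open>M (e e\<^sup>T - f f\<^sup>T)\<close>.\<close>

definition signed_trace :: "'h::real_inner \<Rightarrow> 'h \<Rightarrow> ('h \<Rightarrow> 'h) \<Rightarrow> real" where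
  "signed_trace e f M = e \<bullet> M e - f \<bullet> M f"

lemma projections_eq_if_id:
  assumes "orthonormal_columns K P" "PPt K P = (\<lambda>v. v)" "M \<in> projections K"
  shows "M = PPt K P"
  using assms PPt_eqI[OF _ assms(1)] by (auto simp: projections_def)

text \<open>No projection exceeds \<open>e \<bullet> e\<close>, which is attained by fixing
  \<open>e\<close> and annihilating \<open>f\<close>. In the two degenerate cases there is only one
  projection.\<close>

lemma signed_trace_le_if_captures:
  assumes P: "orthonormal_columns K P" and "captures K e f (PPt K P)" and M: "M \<in> projections K"
  shows "signed_trace e f M \<le> signed_trace e f (PPt K P)"
proof -
  from M obtain Q where Q: "orthonormal_columns K Q" and M_eq: "M = PPt K Q"
    by (auto simp: projections_def)
  consider "K = 0" | "PPt K P = (\<lambda>v. v)" | "PPt K P e = e" "PPt K P f = 0"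
    using assms(2) by (auto simp: captures_def)
  then show ?thesis
  proof cases
    case 1
    then show ?thesis by (simp add: M_eq PPt_def signed_trace_def)
  next
    case 2
    then show ?thesis using projections_eq_if_id[OF P _ M] by simp
  next
    case 3
    have "(norm (PPt K Q e))\<^sup>2 \<le> (norm e)\<^sup>2" using norm_PPt_le[OF Q] by (simp add: power_mono)
    also have "\<dots> = signed_trace e f (PPt K P)"
      using 3 by (simp add: signed_trace_def power2_norm_eq_inner)
    finally show ?thesis
      unfolding M_eq by (subst signed_trace_def) (simp add: inner_PPt_self[OF Q] add_increasing2 diff_le_eq)
  qed
qed

text \<open>Comparison with a projection from \<open>exists_captures\<close> forces equality in both
  estimates behind the upper bound: no length of \<open>e\<close> is lost and none of
  \<open>f\<close> is kept.\<close>

lemma captures_if_signed_trace_max: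
  assumes "e \<bullet> f = 0" and Q: "orthonormal_columns K Q"
    and max: "\<And>M. M \<in> projections K \<Longrightarrow> signed_trace e f M \<le> signed_trace e f (PPt K Q)"
  shows "captures K e f (PPt K Q)"
proof -
  from exists_captures[OF assms(1) Q] obtain P where P: "orthonormal_columns K P"
    and cap: "captures K e f (PPt K P)" by metis
  have PM: "PPt K P \<in> projections K" and QM: "PPt K Q \<in> projections K"
    using P Q by (auto simp: projections_def)
  consider "K = 0" | "PPt K P = (\<lambda>v. v)" | "PPt K P e = e" "PPt K P f = 0"
    using cap by (auto simp: captures_def)
  then show ?thesis
  proof cases
    case 1
    then show ?thesis by (simp add: captures_def)
  next
    case 2
    then show ?thesis using projections_eq_if_id[OF P _ QM] cap by simp
  next
    case 3
    then have *: "(norm e)\<^sup>2 + (norm (PPt K Q f))\<^sup>2 \<le> (norm (PPt K Q e))\<^sup>2"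
      using max[OF PM] by (simp add: signed_trace_def inner_PPt_self[OF Q] power2_norm_eq_inner)
    then have Qe: "PPt K Q e = e"
      by (intro PPt_fixed[OF Q]) (smt (verit) zero_le_power2)
    then have "PPt K Q f = 0" using * by simp
    then show ?thesis using Qe by (simp add: captures_def)
  qed
qed

section \<open>Diagonalizing the symmetrized product\<close>

text \<open>
  With \<open>b\<close> and \<open>w\<close> rescaled to equal norms, \<open>b w\<^sup>T + w b\<^sup>T\<close> is diagonalized by their sum and
  difference, which are orthogonal.
\<close>

lemma symmetrized_product_signed_form:
  fixes b w :: "'h::real_inner"
  obtains e f where "e \<bullet> f = 0"
    "\<And>v. (1/2) *\<^sub>R ((w \<bullet> v) *\<^sub>R b + (b \<bullet> v) *\<^sub>R w) = signed_form e f v"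
proof (cases "b = 0 \<or> w = 0")
  case True
  then show thesis by (intro that[of 0 0]) (auto simp: signed_form_def)
next
  case False
  \<comment> \<open>This \<open>t\<close> gives \<open>t *\<^sub>R b\<close> and
    \<open>(1/t) *\<^sub>R w\<close> equal norms. The extra halves in \<open>p\<close> and
    \<open>q\<close> make the cross terms of the form, which carry a factor 2, add up to the
    required factor 1/2.\<close>
  define t where "t = sqrt (norm w / norm b)"
  have t2: "t * t = norm w / norm b" by (simp add: t_def)
  have "t \<noteq> 0" using False by (simp add: t_def)
  define p where "p = (t / 2) *\<^sub>R b"
  define q where "q = (1 / (2 * t)) *\<^sub>R w"
  have "p \<bullet> p = (t * t) * (norm b * norm b) / 4"
    by (simp add: p_def power2_norm_eq_inner[symmetric] power2_eq_square)
  also have "\<dots> = norm w * norm b / 4" using False by (simp add: t2)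
  also have "\<dots> = (norm w * norm w) / (4 * (t * t))" using False by (simp add: t2)
  also have "\<dots> = q \<bullet> q" by (simp add: q_def power2_norm_eq_inner[symmetric] power2_eq_square)
  finally have pq: "p \<bullet> p = q \<bullet> q" .
  have "(1/2) *\<^sub>R ((w \<bullet> v) *\<^sub>R b + (b \<bullet> v) *\<^sub>R w) = signed_form (p + q) (p - q) v" for v
  proof -
    have "signed_form (p + q) (p - q) v = 2 *\<^sub>R ((q \<bullet> v) *\<^sub>R p + (p \<bullet> v) *\<^sub>R q)"
      by (simp add: signed_form_def inner_add_left inner_diff_left algebra_simps
          flip: scaleR_2)
    also have "\<dots> = (1/2) *\<^sub>R ((w \<bullet> v) *\<^sub>R b + (b \<bullet> v) *\<^sub>R w)"
      using \<open>t \<noteq> 0\<close> by (simp add: p_def q_def scaleR_right_distrib)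
    finally show ?thesis by simp
  qed
  moreover have "(p + q) \<bullet> (p - q) = 0"
    using pq by (simp add: inner_add_left inner_diff_right inner_commute[of q p])
  ultimately show thesis by (rule that[rotated])
qed

section \<open>Optimal features for the second-moment operator\<close>

lemma second_moment_operator_sym:
  assumes "has_second_moment_operator D \<phi> S"
  shows "u \<bullet> S v = v \<bullet> S u"
  using assms by (simp add: has_second_moment_operator_def inner_commute mult.commute)

theorem corollary3p4:
  fixes D :: "((real ^ 'd) \<times> (real ^ 'c)) measure"
    and X :: "(real ^ 'd) set"
    and \<phi> :: "real ^ 'd \<Rightarrow> 'h::{real_inner, banach}"
    and \<beta> :: "'c::finite \<Rightarrow> 'h"
    and \<epsilon> :: "(real ^ 'd) \<times> (real ^ 'c) \<Rightarrow> real ^ 'c"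
    and S :: "'h \<Rightarrow> 'h"
    and \<sigma> L \<Delta> :: real
    and K :: nat
    and c :: 'c
  assumes "prob_space D"
    and "sets D = sets (restrict_space borel X \<Otimes>\<^sub>M borel)"
    and "AE (x, y) in D. y = linear_model \<phi> \<beta> x + \<epsilon> (x, y)"
    and "prob_space.indep_vars D (\<lambda>_. borel) (\<lambda>c z. \<epsilon> z $ c) UNIV"
    and "\<And>c. integrable D (\<lambda>z. (\<epsilon> z $ c)\<^sup>2)"
    and "\<And>c. (\<integral>z. \<epsilon> z $ c \<partial>D) = 0"
    and "\<And>c. (\<integral>z. (\<epsilon> z $ c)\<^sup>2 \<partial>D) \<le> \<sigma>\<^sup>2"
    and "L-lipschitz_on X \<phi>"
    and "0 \<le> \<Delta>"
    and "has_second_moment_operator D \<phi> S"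
    and "projections K \<noteq> ({} :: ('h \<Rightarrow> 'h) set)"
  shows "(\<exists>U. top_eigenvectors K (class_operator S (\<beta> c)) U) \<and>
    (\<forall>U. top_eigenvectors K (class_operator S (\<beta> c)) U \<longrightarrow>
       is_arg_max (robustness_lower_bound L \<Delta> \<sigma> S (\<beta> c)) (\<lambda>M. M \<in> projections K) (PPt K U)) \<and>
    optimal_features K X \<phi> (robustness_lower_bound L \<Delta> \<sigma> S (\<beta> c)) =
      {\<lambda>x\<in>X. PPt K U (\<phi> x) | U. top_eigenvectors K (class_operator S (\<beta> c)) U}"
proof -
  let ?b = "\<beta> c"
  let ?B = "class_operator S ?b"
  let ?J = "robustness_lower_bound L \<Delta> \<sigma> S ?b"
  note S_sym = second_moment_operator_sym[OF assms(10)]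
  obtain e f where ef: "e \<bullet> f = 0"
    and *: "\<And>v. (1/2) *\<^sub>R ((S ?b \<bullet> v) *\<^sub>R ?b + (?b \<bullet> v) *\<^sub>R S ?b) = signed_form e f v"
    using symmetrized_product_signed_form[of "S ?b" ?b] by metis
  have B: "?B = signed_form e f"
  proof
    fix v
    have "?b \<bullet> S v = S ?b \<bullet> v" by (metis S_sym inner_commute)
    then show "?B v = signed_form e f v" by (simp add: class_operator_def *)
  qed
  \<comment> \<open>The penalty shared by all projections of rank \<open>K\<close>: their operator
    norm is 1, except that for \<open>K = 0\<close> the only one is the zero operator.\<close>
  define C where "C = L * \<Delta> * (if K = 0 then 0 else 1) * norm ?b * sqrt (\<sigma>\<^sup>2 + ?b \<bullet> S ?b)"
  have J: "?J M = signed_trace e f M - C" if "M \<in> projections K" for M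
  proof -
    from that obtain P where P: "orthonormal_columns K P" and M: "M = PPt K P"
      by (auto simp: projections_def)
    have "?b \<bullet> S (M ?b) = S ?b \<bullet> PPt K P ?b"
      unfolding M by (metis S_sym inner_commute)
    \<comment> \<open>Symmetrizing does not affect the quadratic form: at \<open>P i\<close> both
      halves of the class operator contribute the same product.\<close>
    also have "\<dots> = (\<Sum>i<K. P i \<bullet> signed_form e f (P i))"
      unfolding inner_PPt *[symmetric]
      by (simp add: inner_add_right inner_commute mult.commute)
    also have "\<dots> = signed_trace e f M"
      unfolding signed_trace_def M inner_PPt
      by (simp add: signed_form_def inner_diff_right inner_commute sum_subtractf)
    finally show ?thesis
      by (simp add: robustness_lower_bound_def C_def M onorm_PPt[OF P])
  qed
  have arg_max: "is_arg_max ?J (\<lambda>M. M \<in> projections K) M \<longleftrightarrow>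
    M \<in> projections K \<and> (\<forall>N \<in> projections K. signed_trace e f N \<le> signed_trace e f M)" for M
    by (auto simp: is_arg_max_linorder J)
  have top_max: "is_arg_max ?J (\<lambda>M. M \<in> projections K) (PPt K U)" if "top_eigenvectors K ?B U" for U
  proof -
    have U: "orthonormal_columns K U" using that by (simp add: top_eigenvectors_def)
    have "captures K e f (PPt K U)"
      using that unfolding B by (rule captures_if_top_eigenvectors[OF ef])
    then show ?thesis unfolding arg_max
      using U signed_trace_le_if_captures[OF U] by (auto simp: projections_def)
  qed
  have max_top: "\<exists>U. top_eigenvectors K ?B U \<and> M = PPt K U"
    if max: "is_arg_max ?J (\<lambda>M. M \<in> projections K) M" for M
  proof -
    from max obtain P where P: "orthonormal_columns K P" and M: "M = PPt K P"
      unfolding arg_max by (auto simp: projections_def)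
    have "captures K e f (PPt K P)"
      using max unfolding arg_max M by (intro captures_if_signed_trace_max[OF ef P]) blast
    then show ?thesis using top_eigenvectors_if_captures[OF ef P] unfolding B M by metis
  qed
  have "\<exists>U. top_eigenvectors K ?B U"
  proof -
    \<comment> \<open>Nonemptiness of \<open>projections K\<close> supplies the \<open>K\<close>
      orthonormal vectors from which a capturing projection is built.\<close>
    from assms(11) obtain P0 :: "nat \<Rightarrow> 'h" where "orthonormal_columns K P0"
      by (auto simp: projections_def)
    from exists_captures[OF ef this] obtain P where "orthonormal_columns K P"
      "captures K e f (PPt K P)" by metis
    from top_eigenvectors_if_captures[OF ef this] show ?thesis unfolding B by metis
  qed
  moreover have "optimal_features K X \<phi> ?J =
      {\<lambda>x\<in>X. PPt K U (\<phi> x) | U. top_eigenvectors K ?B U}"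
    unfolding optimal_features_def using top_max max_top by blast
  ultimately show ?thesis using top_max by blast
qed

end
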